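(* Let $\mathfrak{R}$ be the class of all finite ultrametric spaces $(X,d)$ satisfying $\min_{g\in\operatorname{Iso}(X)}|\operatorname{Fix}(g)|=|X|-2$. If $X\in\mathfrak{R}$, then every subspace $Y$ of $X$ with $|Y|\geq 2$ also belongs to $\mathfrak{R}$.
   Context: $\operatorname{Iso}(X)$ is the group of isometries of $(X,d)$ onto itself, and $\operatorname{Fix}(g)$ is the set of fixed points of $g\colon X\to X$. Subspaces carry the restricted metric. *)

theory Defs
  imports "HOL-Analysis.Analysis"
begin

definition ultrametric :: "'a metric \<Rightarrow> bool" where
  "ultrametric X \<longleftrightarrow>
     (\<forall>x\<in>mspace X. \<forall>y\<in>mspace X. \<forall>z\<in>mspace X.
        mdist X x z \<le> max (mdist X x y) (mdist X y z))"

text \<open>Self-maps of a space are represented by extensional functions, so that each map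
  of the space occurs exactly once.\<close>

definition isometries :: "'a metric \<Rightarrow> ('a \<Rightarrow> 'a) set" where
  "isometries X =
     {g \<in> extensional (mspace X). bij_betw g (mspace X) (mspace X) \<and>
        (\<forall>x\<in>mspace X. \<forall>y\<in>mspace X. mdist X (g x) (g y) = mdist X x y)}"

definition fixed_points :: "'a metric \<Rightarrow> ('a \<Rightarrow> 'a) \<Rightarrow> 'a set" where
  "fixed_points X g = {x \<in> mspace X. g x = x}"

text \<open>The subtraction is performed on integers, so that it does not truncate when the
  space has fewer than two points.\<close>

definition class_R :: "'a metric set" where
  "class_R =
     {X. finite (mspace X) \<and> ultrametric X \<and>
         int (Min ((\<lambda>g. card (fixed_points X g)) ` isometries X)) = int (card (mspace X)) - 2}"

end

theory Submission
  imports Defs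
begin

text \<open>Call two points twins if every other point is equidistant from them. Transposing
  twins is an isometry, and two different twin pairs compose to an isometry moving at least
  three points, so a space in the class has only one twin pair. On the other hand a closest
  pair in a set whose points cannot be told apart by distances to outside points is a twin pair.
  Applied to suitable balls, this makes the distance \<open>f x\<close> to a fixed twin \<open>p\<close> injective
  and gives \<open>d x y = max (f x) (f y)\<close> for \<open>x \<noteq> y\<close>. Such a representation
  is inherited by subspaces and leaves no room for isometries that move three points.\<close>

section \<open>Twins, indiscernible sets and basic ultrametric facts\<close>

definition twins :: "'a metric \<Rightarrow> 'a \<Rightarrow> 'a \<Rightarrow> bool" where
  "twins X a b \<longleftrightarrow> a \<in> mspace X \<and> b \<in> mspace X \<and> a \<noteq> b \<and>
     (\<forall>z\<in>mspace X - {a, b}. mdist X a z = mdist X b z)"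

text \<open>The metric analogue of a module of a graph. Only points outside \<open>S\<close> are
  compared with, so the whole space qualifies vacuously.\<close>

definition indiscernible :: "'a metric \<Rightarrow> 'a set \<Rightarrow> bool" where
  "indiscernible X S \<longleftrightarrow> S \<subseteq> mspace X \<and>
     (\<forall>s\<in>S. \<forall>t\<in>S. \<forall>z\<in>mspace X - S. mdist X s z = mdist X t z)"

lemma card_ge_2_obtains:
  assumes "card A \<ge> 2"
  obtains x y where "x \<in> A" "y \<in> A" "x \<noteq> y"
proof -
  have "finite A"
    using assms card.infinite by fastforce
  then show ?thesis
    using assms that card_le_Suc0_iff_eq[of A] by fastforce
qed

lemma mdist_self: "x \<in> mspace X \<Longrightarrow> mdist X x x = 0"
  by simp

lemma ultrametricD:
  assumes "ultrametric X" "x \<in> mspace X" "y \<in> mspace X" "z \<in> mspace X"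
  shows "mdist X x z \<le> max (mdist X x y) (mdist X y z)"
  using assms unfolding ultrametric_def by blast

lemma ultrametric_submetric: "ultrametric X \<Longrightarrow> ultrametric (submetric X Y)"
  by (auto simp: ultrametric_def)

section \<open>Isometries and the number of points they move\<close>

lemma restrict_in_isometries:
  assumes "bij_betw h (mspace X) (mspace X)"
    and "\<And>x y. x \<in> mspace X \<Longrightarrow> y \<in> mspace X \<Longrightarrow> mdist X (h x) (h y) = mdist X x y"
  shows "restrict h (mspace X) \<in> isometries X"
  using assms by (simp add: isometries_def cong: bij_betw_cong)

lemma finite_isometries:
  assumes "finite (mspace X)"
  shows "finite (isometries X)"
proof (rule finite_subset)
  show "isometries X \<subseteq> mspace X \<rightarrow>\<^sub>E mspace X"
    by (auto simp: isometries_def bij_betw_def PiE_def)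
  show "finite (mspace X \<rightarrow>\<^sub>E mspace X)"
    using assms by (simp add: finite_PiE)
qed

text \<open>Turns the minimum in \<open>class_R\<close> into a condition on moved points: a finite
  ultrametric space is in the class iff no isometry moves more than two points and some isometry
  moves exactly two.\<close>

lemma card_fixed_points_add_moved:
  assumes "finite (mspace X)"
  shows "card (fixed_points X g) + card {x \<in> mspace X. g x \<noteq> x} = card (mspace X)"
proof -
  have "mspace X = fixed_points X g \<union> {x \<in> mspace X. g x \<noteq> x}"
    by (auto simp: fixed_points_def)
  moreover have "fixed_points X g \<inter> {x \<in> mspace X. g x \<noteq> x} = {}"
    by (auto simp: fixed_points_def)
  ultimately show ?thesis
    using assms by (metis card_Un_disjoint finite_Un)
qed

lemma class_R_card_moved_le_2:
  assumes "X \<in> class_R" "g \<in> isometries X"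
  shows "card {x \<in> mspace X. g x \<noteq> x} \<le> 2"
proof -
  have fin: "finite (mspace X)"
    and m: "int (Min ((\<lambda>g. card (fixed_points X g)) ` isometries X)) = int (card (mspace X)) - 2"
    using assms(1) by (auto simp: class_R_def)
  have "Min ((\<lambda>g. card (fixed_points X g)) ` isometries X) \<le> card (fixed_points X g)"
    using assms(2) finite_isometries[OF fin] by (intro Min_le) auto
  then show ?thesis
    using m card_fixed_points_add_moved[OF fin, of g] by linarith
qed

lemma class_RI:
  assumes "finite (mspace X)" "ultrametric X"
    and le: "\<And>g. g \<in> isometries X \<Longrightarrow> card {x \<in> mspace X. g x \<noteq> x} \<le> 2"
    and g: "g \<in> isometries X" "card {x \<in> mspace X. g x \<noteq> x} = 2"
  shows "X \<in> class_R"
proof -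
  note moved = card_fixed_points_add_moved[OF assms(1)]
  have "Min ((\<lambda>g. card (fixed_points X g)) ` isometries X) = card (fixed_points X g)"
  proof (rule Min_eqI)
    show "finite ((\<lambda>g. card (fixed_points X g)) ` isometries X)"
      using finite_isometries[OF assms(1)] by simp
    show "card (fixed_points X g) \<le> y"
      if y: "y \<in> (\<lambda>g. card (fixed_points X g)) ` isometries X" for y
    proof -
      obtain h where h: "h \<in> isometries X" "y = card (fixed_points X h)"
        using y by blast
      show ?thesis
        using le[OF h(1)] moved[of h] moved[of g] g(2) h(2) by linarith
    qed
  qed (use g in blast)
  then show ?thesis
    using assms(1,2) g(2) moved[of g] by (simp add: class_R_def)
qed

section \<open>Transpositions of twins and the existence of twins\<close>

lemma mdist_transpose:
  assumes "twins X a b" "x \<in> mspace X" "y \<in> mspace X"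
  shows "mdist X (Transposition.transpose a b x) (Transposition.transpose a b y) = mdist X x y"
proof -
  have eq: "mdist X a z = mdist X b z" if "z \<in> mspace X" "z \<noteq> a" "z \<noteq> b" for z
    using assms(1) that by (simp add: twins_def)
  have zero: "mdist X a a = 0" "mdist X b b = 0"
    using assms(1) by (simp_all add: twins_def)
  show ?thesis
    unfolding Transposition.transpose_def
    using assms(2,3) eq zero mdist_commute[of X] by (smt (verit))
qed

lemma twins_isometry:
  assumes "twins X a b"
  shows "restrict (Transposition.transpose a b) (mspace X) \<in> isometries X"
proof (rule restrict_in_isometries)
  show "bij_betw (Transposition.transpose a b) (mspace X) (mspace X)"
    using assms by (simp add: twins_def)
qed (rule mdist_transpose[OF assms])

lemma twins_subset_of_moved_le_2:
  assumes fin: "finite (mspace X)"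
    and le: "\<And>g. g \<in> isometries X \<Longrightarrow> card {x \<in> mspace X. g x \<noteq> x} \<le> 2"
    and ab: "twins X a b" and cd: "twins X c d"
  shows "c \<in> {a, b}"
proof (rule ccontr)
  assume c: "c \<notin> {a, b}"
  define h where "h = Transposition.transpose a b \<circ> Transposition.transpose c d"
  define g where "g = restrict h (mspace X)"
  have pts: "a \<in> mspace X" "b \<in> mspace X" "c \<in> mspace X" "d \<in> mspace X" "a \<noteq> b" "c \<noteq> d"
    using ab cd by (auto simp: twins_def)
  have "g \<in> isometries X"
    unfolding g_def
  proof (rule restrict_in_isometries)
    show "bij_betw h (mspace X) (mspace X)"
      unfolding h_def using pts by (intro bij_betw_trans[where B = "mspace X"]) simp_all
    show "mdist X (h x) (h y) = mdist X x y" if "x \<in> mspace X" "y \<in> mspace X" for x y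
    proof -
      have "Transposition.transpose c d x \<in> mspace X" "Transposition.transpose c d y \<in> mspace X"
        using that pts by (auto simp: Transposition.transpose_def)
      then show ?thesis
        using that by (simp add: h_def mdist_transpose[OF ab] mdist_transpose[OF cd])
    qed
  qed
  then have "card {x \<in> mspace X. g x \<noteq> x} \<le> 2"
    by (rule le)
  \<comment> \<open>Overlapping pairs are covered as well. The inner swap fixes \<open>a\<close> or,
    if \<open>a = d\<close>, sends it to \<open>c\<close>, which the outer swap fixes; likewise for
    \<open>b\<close>. The point \<open>c\<close> goes to \<open>d\<close> or, if \<open>d\<close> is
    one of \<open>a\<close>, \<open>b\<close>, to the other one.\<close>
  moreover have "{a, b, c} \<subseteq> {x \<in> mspace X. g x \<noteq> x}"
    using pts c by (auto simp: g_def h_def Transposition.transpose_def)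
  then have "card {a, b, c} \<le> card {x \<in> mspace X. g x \<noteq> x}"
    using fin by (intro card_mono) auto
  moreover have "card {a, b, c} = 3"
    using pts c by auto
  ultimately show False
    by linarith
qed

text \<open>Take \<open>a\<close>, \<open>b\<close> at minimal distance in \<open>S\<close>. For
  another \<open>z\<close> in \<open>S\<close>, the term \<open>mdist X a b\<close> never exceeds
  the other term in the ultrametric inequalities, so \<open>z\<close> is equidistant from both; for
  \<open>z\<close> outside \<open>S\<close> this is indiscernibility.\<close>

lemma indiscernible_twins:
  assumes u: "ultrametric X" and fin: "finite (mspace X)"
    and S: "indiscernible X S" and xy: "x \<in> S" "y \<in> S" "x \<noteq> y"
  obtains a b where "a \<in> S" "b \<in> S" "twins X a b"
proof -
  define P where "P = {(s, t). s \<in> S \<and> t \<in> S \<and> s \<noteq> t}"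
  have sub: "S \<subseteq> mspace X"
    using S by (simp add: indiscernible_def)
  have "P \<subseteq> S \<times> S"
    by (auto simp: P_def)
  then have finP: "finite P"
    using fin sub by (meson finite_SigmaI finite_subset)
  have "P \<noteq> {}"
    using xy by (auto simp: P_def)
  define q where "q = arg_min_on (\<lambda>(s, t). mdist X s t) P"
  have "q \<in> P"
    unfolding q_def by (rule arg_min_if_finite(1)[OF finP \<open>P \<noteq> {}\<close>])
  obtain a b where q: "q = (a, b)"
    by fastforce
  have ab: "a \<in> S" "b \<in> S" "a \<noteq> b"
    using \<open>q \<in> P\<close> q by (auto simp: P_def)
  have min: "mdist X a b \<le> mdist X s t" if "s \<in> S" "t \<in> S" "s \<noteq> t" for s t
    using arg_min_least[OF finP \<open>P \<noteq> {}\<close>, of "(s, t)" "\<lambda>(s, t). mdist X s t"] that q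
    by (auto simp: P_def q_def)
  have "mdist X a z = mdist X b z" if z: "z \<in> mspace X" "z \<noteq> a" "z \<noteq> b" for z
  proof (cases "z \<in> S")
    case True
    have "mdist X a b \<le> mdist X a z" "mdist X a b \<le> mdist X b z"
      using min ab True z by auto
    moreover have "mdist X a z \<le> max (mdist X a b) (mdist X b z)"
      "mdist X b z \<le> max (mdist X b a) (mdist X a z)"
      using ultrametricD[OF u] ab z sub by blast+
    ultimately show ?thesis
      using mdist_commute[of X a b] by linarith
  next
    case False
    then show ?thesis
      using S ab z unfolding indiscernible_def by blast
  qed
  then have "twins X a b"
    using ab sub by (auto simp: twins_def)
  then show ?thesis
    using that ab by blast
qed

section \<open>Distances as maxima of an injective function\<close>

lemma max_representation:
  assumes u: "ultrametric X" and fin: "finite (mspace X)"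
    and le: "\<And>g. g \<in> isometries X \<Longrightarrow> card {x \<in> mspace X. g x \<noteq> x} \<le> 2"
    and two: "card (mspace X) \<ge> 2"
  obtains f :: "'a \<Rightarrow> real" where "inj_on f (mspace X)"
    "\<And>x y. x \<in> mspace X \<Longrightarrow> y \<in> mspace X \<Longrightarrow> x \<noteq> y \<Longrightarrow> mdist X x y = max (f x) (f y)"
proof -
  let ?M = "mspace X" and ?d = "mdist X"
  have "indiscernible X ?M"
    by (simp add: indiscernible_def)
  moreover obtain x y where "x \<in> ?M" "y \<in> ?M" "x \<noteq> y"
    using card_ge_2_obtains[OF two] .
  ultimately obtain p p' where pp: "twins X p p'"
    using indiscernible_twins[OF u fin] by metis
  then have p: "p \<in> ?M"
    by (simp add: twins_def)
  \<comment> \<open>Such an \<open>S\<close> contains a twin pair, and \<open>p\<close>, being a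
    twin itself, must be one of its two points.\<close>
  have p_in: "p \<in> S" if S: "indiscernible X S" "x \<in> S" "y \<in> S" "x \<noteq> y" for S x y
  proof -
    obtain a b where "a \<in> S" "b \<in> S" "twins X a b"
      using indiscernible_twins[OF u fin S] by metis
    then show ?thesis
      using twins_subset_of_moved_le_2[OF fin le _ pp, of a b] by auto
  qed
  define f where "f x = ?d x p" for x
  have f_le: "f x \<le> ?d x y" if xy: "x \<in> ?M" "y \<in> ?M" "x \<noteq> y" for x y
  proof -
    \<comment> \<open>A closed ball: its points are within the radius of each other, outside points
      are farther away than that. The inequality \<open>far\<close> is symmetric in \<open>s\<close>
      and \<open>t\<close>, so it yields equality.\<close>
    let ?S = "{z \<in> ?M. ?d x z \<le> ?d x y}"
    have far: "?d s z \<le> ?d t z" if "s \<in> ?S" "t \<in> ?S" "z \<in> ?M - ?S" for s t z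
    proof -
      have "?d s z \<le> max (?d s t) (?d t z)" "?d s t \<le> max (?d s x) (?d x t)"
        "?d x z \<le> max (?d x t) (?d t z)"
        using that xy by (auto intro!: ultrametricD[OF u] simp del: le_max_iff_disj)
      then show ?thesis
        using that mdist_commute[of X s x] by auto
    qed
    have "indiscernible X ?S"
      unfolding indiscernible_def using far by (auto intro!: antisym)
    moreover have "x \<in> ?S" "y \<in> ?S"
      using xy by (simp_all add: mdist_self)
    ultimately have "p \<in> ?S"
      using p_in xy(3) by blast
    then show ?thesis
      by (simp add: f_def)
  qed
  \<comment> \<open>The ultrametric inequality through \<open>p\<close> gives the upper bound,
    \<open>f_le\<close> in both orders the lower one.\<close>
  have max: "?d x y = max (f x) (f y)" if xy: "x \<in> ?M" "y \<in> ?M" "x \<noteq> y" for x y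
  proof -
    have "?d x y \<le> max (?d x p) (?d p y)"
      using ultrametricD[OF u] xy p by blast
    then show ?thesis
      using f_le[OF xy] f_le[OF xy(2,1)] xy(3) mdist_commute[of X p y] mdist_commute[of X y x]
      by (simp add: f_def)
  qed
  have "inj_on f ?M"
  proof (rule inj_onI, rule ccontr)
    fix x y assume x: "x \<in> ?M" and y: "y \<in> ?M" and eq: "f x = f y" and ne: "x \<noteq> y"
    define r where "r = ?d x y"
    have r: "?d x p = r" "?d y p = r"
      using max[OF x y ne] eq by (auto simp: r_def f_def)
    \<comment> \<open>Here \<open>x\<close>, \<open>y\<close>, \<open>p\<close> are pairwise at
      distance \<open>r\<close>. Two open balls are united so that the set has two points but misses
      \<open>p\<close>; being indiscernible, it would have to contain \<open>p\<close>.\<close>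
    let ?S = "{z \<in> ?M. ?d x z < r \<or> ?d y z < r}"
    have dist_x: "?d x s \<le> r" if "s \<in> ?S" for s
    proof -
      have "?d x s \<le> max r (?d y s)"
        using ultrametricD[OF u x y, of s] that by (simp add: r_def)
      then show ?thesis
        using that by auto
    qed
    \<comment> \<open>Points of the union are at most \<open>r\<close> apart, while outside points
      are at least \<open>r\<close> away from each of them.\<close>
    have far: "?d s z \<le> ?d t z" if "s \<in> ?S" "t \<in> ?S" "z \<in> ?M - ?S" for s t z
    proof -
      have "?d s t \<le> max (?d s x) (?d x t)"
        using that x by (intro ultrametricD[OF u]) auto
      then have near: "?d s t \<le> r"
        using dist_x[OF that(1)] dist_x[OF that(2)] mdist_commute[of X s x] by simp
      have "r \<le> ?d t z"
      proof -
        have "?d x z \<le> max (?d x t) (?d t z)" "?d y z \<le> max (?d y t) (?d t z)"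
          using that x y by (auto intro!: ultrametricD[OF u] simp del: le_max_iff_disj)
        then show ?thesis
          using that by auto
      qed
      moreover have "?d s z \<le> max (?d s t) (?d t z)"
        using that by (auto intro!: ultrametricD[OF u] simp del: le_max_iff_disj)
      ultimately show ?thesis
        using near by linarith
    qed
    have "indiscernible X ?S"
      unfolding indiscernible_def using far by (auto intro!: antisym)
    moreover have "0 < r"
      using x y ne by (simp add: r_def order_less_le)
    then have "x \<in> ?S" "y \<in> ?S"
      using x y by (simp_all add: mdist_self)
    ultimately have "p \<in> ?S"
      using p_in ne by blast
    then show False
      using r by simp
  qed
  then show ?thesis
    using that max by blast
qed

text \<open>Let \<open>x\<close> be the moved point with the largest \<open>f\<close>. Any other
  moved \<open>y\<close> has distance \<open>f x\<close> from it, and so have the images; among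
  moved points only \<open>x\<close> attains this value, and \<open>g x\<close> is not
  \<open>x\<close>, so \<open>g y = x\<close>. Injectivity of \<open>g\<close> allows only one such
  \<open>y\<close>.\<close>

lemma max_representation_moved_le_2:
  fixes f :: "'a \<Rightarrow> real"
  assumes fin: "finite (mspace X)" and inj: "inj_on f (mspace X)"
    and max: "\<And>x y. x \<in> mspace X \<Longrightarrow> y \<in> mspace X \<Longrightarrow> x \<noteq> y \<Longrightarrow> mdist X x y = max (f x) (f y)"
    and g: "g \<in> isometries X"
  shows "card {x \<in> mspace X. g x \<noteq> x} \<le> 2"
proof (rule ccontr)
  define M where "M = {x \<in> mspace X. g x \<noteq> x}"
  assume "\<not> card {x \<in> mspace X. g x \<noteq> x} \<le> 2"
  then have card: "card M \<ge> 3"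
    by (simp add: M_def)
  have finM: "finite M" and MX: "M \<subseteq> mspace X"
    using fin by (auto simp: M_def)
  have gX: "g x \<in> mspace X" if "x \<in> mspace X" for x
    using g that by (auto simp: isometries_def bij_betw_def)
  have g_inj: "g x \<noteq> g y" if "x \<in> mspace X" "y \<in> mspace X" "x \<noteq> y" for x y
    using g that by (auto simp: isometries_def bij_betw_def inj_on_def)
  have gM: "g x \<in> M" if "x \<in> M" for x
    using that gX g_inj by (simp add: M_def)
  have gd: "mdist X (g x) (g y) = mdist X x y" if "x \<in> mspace X" "y \<in> mspace X" for x y
    using g that by (simp add: isometries_def)
  have "M \<noteq> {}"
    using card by auto
  \<comment> \<open>A maximiser of \<open>f\<close>, found by minimising \<open>- f\<close>; it is
    strict because \<open>f\<close> is injective.\<close>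
  define x where "x = arg_min_on (\<lambda>x. - f x) M"
  have x: "x \<in> M"
    unfolding x_def by (rule arg_min_if_finite(1)[OF finM \<open>M \<noteq> {}\<close>])
  have less: "f y < f x" if "y \<in> M" "y \<noteq> x" for y
  proof -
    have "f y \<le> f x"
      using arg_min_least[OF finM \<open>M \<noteq> {}\<close> that(1), of "\<lambda>x. - f x"] by (simp add: x_def)
    moreover have "f y \<noteq> f x"
      using inj that x MX by (auto dest: inj_onD)
    ultimately show ?thesis
      by simp
  qed
  have to_x: "g y = x" if y: "y \<in> M" "y \<noteq> x" for y
  proof (rule ccontr)
    assume gy: "g y \<noteq> x"
    have gx: "g x \<noteq> x"
      using x by (simp add: M_def)
    have "max (f (g x)) (f (g y)) = mdist X (g x) (g y)"
      using max g_inj gX x y MX by (metis subsetD)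
    also have "\<dots> = mdist X x y"
      using gd x y MX by blast
    also have "\<dots> = max (f x) (f y)"
      using max x y MX by blast
    also have "\<dots> = f x"
      using less[OF y] by simp
    finally show False
      using less[OF gM[OF x] gx] less[OF gM[OF y(1)] gy] by simp
  qed
  have "2 \<le> card (M - {x})"
    using card x finM by simp
  then obtain y z where "y \<in> M - {x}" "z \<in> M - {x}" "y \<noteq> z"
    by (rule card_ge_2_obtains)
  then show False
    using to_x[of y] to_x[of z] g_inj[of y z] MX by auto
qed

section \<open>Attaining the minimum, and passage to subspaces\<close>

lemma ultrametric_isometry_moving_2:
  assumes u: "ultrametric X" and fin: "finite (mspace X)" and two: "card (mspace X) \<ge> 2"
  obtains g where "g \<in> isometries X" "card {x \<in> mspace X. g x \<noteq> x} = 2"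
proof -
  have "indiscernible X (mspace X)"
    by (simp add: indiscernible_def)
  moreover obtain x y where "x \<in> mspace X" "y \<in> mspace X" "x \<noteq> y"
    using card_ge_2_obtains[OF two] .
  ultimately obtain a b where ab: "twins X a b"
    using indiscernible_twins[OF u fin] by metis
  let ?g = "restrict (Transposition.transpose a b) (mspace X)"
  have "{x \<in> mspace X. ?g x \<noteq> x} = {a, b}"
    using ab by (auto simp: twins_def Transposition.transpose_def)
  then have "card {x \<in> mspace X. ?g x \<noteq> x} = 2"
    using ab by (simp add: twins_def)
  then show ?thesis
    using that twins_isometry[OF ab] by blast
qed

theorem mainTheorem6:
  fixes X :: "'a metric" and Y :: "'a set"
  assumes "X \<in> class_R"
    and "Y \<subseteq> mspace X" and "card Y \<ge> 2"
  shows "submetric X Y \<in> class_R"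
proof -
  have fin: "finite (mspace X)" and u: "ultrametric X"
    using assms(1) by (auto simp: class_R_def)
  have "card (mspace X) \<ge> 2"
    using assms(3) card_mono[OF fin assms(2)] by linarith
  then obtain f :: "'a \<Rightarrow> real" where f: "inj_on f (mspace X)"
    and max: "\<And>x y. x \<in> mspace X \<Longrightarrow> y \<in> mspace X \<Longrightarrow> x \<noteq> y \<Longrightarrow> mdist X x y = max (f x) (f y)"
    using max_representation[OF u fin class_R_card_moved_le_2[OF assms(1)]] by metis
  let ?Y = "submetric X Y"
  have Y: "mspace ?Y = Y"
    using assms(2) by auto
  have finY: "finite (mspace ?Y)"
    using fin assms(2) Y by (simp add: finite_subset)
  have uY: "ultrametric ?Y"
    using u by (rule ultrametric_submetric)
  have le: "card {x \<in> mspace ?Y. g x \<noteq> x} \<le> 2" if "g \<in> isometries ?Y" for g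
  proof (rule max_representation_moved_le_2[OF finY _ _ that])
    show "inj_on f (mspace ?Y)"
      using f assms(2) Y by (simp add: inj_on_subset)
    show "mdist ?Y x y = max (f x) (f y)"
      if "x \<in> mspace ?Y" "y \<in> mspace ?Y" "x \<noteq> y" for x y
      using max that by simp
  qed
  \<comment> \<open>The bound \<open>le\<close> only keeps the minimum from dropping below
    \<open>card Y - 2\<close>. Equality comes from swapping twins of \<open>Y\<close>, which need
    not be twins in \<open>X\<close>.\<close>
  obtain g where "g \<in> isometries ?Y" "card {x \<in> mspace ?Y. g x \<noteq> x} = 2"
    using ultrametric_isometry_moving_2[OF uY finY] assms(3) Y by metis
  then show ?thesis
    using class_RI[OF finY uY le] by blast
qed

end
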